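(* Let $I\subset\mathbb{R}$ be an interval and let $X: I \rightarrow \mathbb{H}^{2}\subset\mathbb{R}^3_1$ be a regular curve parametrized by arc length $s$. Then $X$ is a soliton solution to the curve shortening flow if, and only if, there is a vector $v \in \mathbb{R}^{3}_1\setminus \{0\}$ such that $$\langle T(s),v\rangle=k(s)\qquad\text{for all } s\in I,$$ where $T(s)$ is the unit tangent vector field and $k(s)$ is the geodesic curvature of $X$.
   Context: $\mathbb{R}^3_1$ is $\mathbb{R}^3$ with the Minkowski metric $\langle u,v\rangle=-u_1v_1+u_2v_2+u_3v_3$, and $\mathbb{H}^2=\{x\in\mathbb{R}^3_1:\langle x,x\rangle=-1,\ x_1>0\}$ with the induced Riemannian metric. The Minkowski cross product $\times$ is determined by $\langle u\times v,w\rangle=\det(u,v,w)$ for all $w$. For a smooth curve $X$ in $\mathbb{H}^2$ parametrized by arc length $s$: $T=X'$ is the unit tangent field, $N=X\times T$ the unit normal field, $k=\langle T',N\rangle$ the geodesic curvature. A one-parameter family of curves $\hat X:I\times J\to\mathbb{H}^2$ ($J$ an interval with $0\in J$; everything smooth) is a curve shortening flow with initial condition $X$ if $$\left\langle \frac{\partial}{\partial t}\hat X(s,t),\hat N(s,t)\right\rangle=\hat k(s,t),\qquad \hat X(s,0)=X(s),$$ for all $(s,t)\in I\times J$, where $\hat k(\cdot,t)$ and $\hat N(\cdot,t)$ are the geodesic curvature and the unit normal field of the curve $\hat X(\cdot,t)$. $X$ is a soliton solution to the curve shortening flow if there is a curve shortening flow $\hat X$ with initial condition $X$ and a (smooth)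 1-parameter family of isometries $M(t):\mathbb{H}^2\to\mathbb{H}^2$, $t\in J$, with $M(0)=\mathrm{Id}$ and $\hat X(s,t)=M(t)X(s)$ for all $s\in I$, $t\in J$. (Isometries of $\mathbb{H}^2$ are the linear maps in $O_1(3)=\{M\in GL(3,\mathbb{R}):M^T\epsilon M=\epsilon\}$, $\epsilon=\mathrm{diag}(-1,1,1)$, that preserve $\mathbb{H}^2$.) *)

theory Defs
  imports "HOL-Analysis.Analysis"
begin

text \<open>
  The space \<open>\<real>\<^sup>3\<^sub>1\<close> is the type \<open>real^3\<close> with the Minkowski product below.
  Intervals may be open, half-open, closed or unbounded, but not a single point, so that
  derivatives within them are uniquely determined. All derivatives are taken within the
  interval, i.e. they are one-sided at an endpoint that belongs to it.
\<close>

definition nondegenerate_interval :: "real set \<Rightarrow> bool" where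
  "nondegenerate_interval I \<longleftrightarrow> is_interval I \<and> interior I \<noteq> {}"

text \<open>
  \<open>Ck_on n S f\<close>: \<open>f\<close> is \<open>n\<close> times continuously differentiable on \<open>S\<close>. The derivative \<open>f'\<close> is
  represented by its directional derivatives \<open>\<lambda>x. f' x h\<close>, which keeps the type of \<open>f\<close>.
  Used only for nondegenerate intervals and products of two of them, where the
  derivative within \<open>S\<close> is unique.
\<close>

primrec Ck_on ::
    "nat \<Rightarrow> 'a::real_normed_vector set \<Rightarrow> ('a \<Rightarrow> 'b::real_normed_vector) \<Rightarrow> bool" where
  "Ck_on 0 S f \<longleftrightarrow> continuous_on S f"
| "Ck_on (Suc n) S f \<longleftrightarrow>
     (\<exists>f'. (\<forall>x\<in>S. (f has_derivative f' x) (at x within S)) \<and> (\<forall>h. Ck_on n S (\<lambda>x. f' x h)))"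

definition smooth_on ::
    "'a::real_normed_vector set \<Rightarrow> ('a \<Rightarrow> 'b::real_normed_vector) \<Rightarrow> bool" where
  "smooth_on S f \<longleftrightarrow> (\<forall>n. Ck_on n S f)"

definition mink :: "real^3 \<Rightarrow> real^3 \<Rightarrow> real" where
  "mink u v = - (u$1 * v$1) + u$2 * v$2 + u$3 * v$3"

definition hyp_plane :: "(real^3) set" where
  "hyp_plane = {x. mink x x = -1 \<and> x$1 > 0}"

definition mcross :: "real^3 \<Rightarrow> real^3 \<Rightarrow> real^3" where
  "mcross u v = (THE z. \<forall>w. mink z w = det (vector [u, v, w]))"

lemma mcross_unique: "\<exists>!z. \<forall>w. mink z w = det (vector [u, v, w] :: real^3^3)"
proof (rule ex1I)
  let ?z = "vector [- (u$2 * v$3 - u$3 * v$2),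
                    u$3 * v$1 - u$1 * v$3, u$1 * v$2 - u$2 * v$1] :: real^3"
  show z: "\<forall>w. mink ?z w = det (vector [u, v, w] :: real^3^3)"
    by (simp add: mink_def det_3 algebra_simps)
  fix y assume "\<forall>w. mink y w = det (vector [u, v, w] :: real^3^3)"
  with z have "mink y w = mink ?z w" for w by simp
  from this[of "axis 1 1"] this[of "axis 2 1"] this[of "axis 3 1"]
  show "y = ?z" by (simp add: mink_def vec_eq_iff forall_3 axis_def)
qed

lemma mink_mcross: "mink (mcross u v) w = det (vector [u, v, w])"
  using theI'[OF mcross_unique] unfolding mcross_def by blast

abbreviation curve_deriv :: "real set \<Rightarrow> (real \<Rightarrow> real^3) \<Rightarrow> real \<Rightarrow> real^3" where
  "curve_deriv I X s \<equiv> vector_derivative X (at s within I)"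

definition regular_curve :: "real set \<Rightarrow> (real \<Rightarrow> real^3) \<Rightarrow> bool" where
  "regular_curve I X \<longleftrightarrow>
     smooth_on I X \<and> X ` I \<subseteq> hyp_plane \<and> (\<forall>s\<in>I. curve_deriv I X s \<noteq> 0)"

text \<open>
  A flow does not preserve arc length parametrization, so the tangent, normal and curvature
  are needed for regular curves with any parameter \<open>s\<close>. Differentiation with respect to
  arc length is then \<open>(1 / speed) d/ds\<close>. For speed \<open>1\<close> the formulas
  read \<open>T = X'\<close>, \<open>N = X \<times> T\<close> and \<open>k = \<langle>T', N\<rangle>\<close>.
\<close>

definition speed :: "real set \<Rightarrow> (real \<Rightarrow> real^3) \<Rightarrow> real \<Rightarrow> real" where
  "speed I X s = sqrt (mink (curve_deriv I X s) (curve_deriv I X s))"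

definition arc_length_parametrized :: "real set \<Rightarrow> (real \<Rightarrow> real^3) \<Rightarrow> bool" where
  "arc_length_parametrized I X \<longleftrightarrow> (\<forall>s\<in>I. speed I X s = 1)"

definition unit_tangent :: "real set \<Rightarrow> (real \<Rightarrow> real^3) \<Rightarrow> real \<Rightarrow> real^3" where
  "unit_tangent I X s = (1 / speed I X s) *\<^sub>R curve_deriv I X s"

definition unit_normal :: "real set \<Rightarrow> (real \<Rightarrow> real^3) \<Rightarrow> real \<Rightarrow> real^3" where
  "unit_normal I X s = mcross (X s) (unit_tangent I X s)"

definition geodesic_curvature :: "real set \<Rightarrow> (real \<Rightarrow> real^3) \<Rightarrow> real \<Rightarrow> real" where
  "geodesic_curvature I X s =
     mink ((1 / speed I X s) *\<^sub>R curve_deriv I (unit_tangent I X) s) (unit_normal I X s)"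

definition curve_shortening_flow ::
    "real set \<Rightarrow> real set \<Rightarrow> (real \<Rightarrow> real^3) \<Rightarrow> (real \<Rightarrow> real \<Rightarrow> real^3) \<Rightarrow> bool" where
  "curve_shortening_flow I J X Y \<longleftrightarrow>
     nondegenerate_interval J \<and> 0 \<in> J \<and>
     smooth_on (I \<times> J) (\<lambda>(s, t). Y s t) \<and>
     (\<forall>t\<in>J. regular_curve I (\<lambda>s. Y s t)) \<and>
     (\<forall>s\<in>I. \<forall>t\<in>J.
        mink (vector_derivative (\<lambda>\<tau>. Y s \<tau>) (at t within J)) (unit_normal I (\<lambda>\<sigma>. Y \<sigma> t) s)
          = geodesic_curvature I (\<lambda>\<sigma>. Y \<sigma> t) s) \<and>
     (\<forall>s\<in>I. Y s 0 = X s)"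

definition mink_form :: "real^3^3" where
  "mink_form = vector [vector [-1, 0, 0], vector [0, 1, 0], vector [0, 0, 1]]"

definition lorentz_group :: "(real^3^3) set" where
  "lorentz_group = {M. invertible M \<and> transpose M ** mink_form ** M = mink_form}"

definition hyp_isometries :: "(real^3^3) set" where
  "hyp_isometries = {M \<in> lorentz_group. (\<lambda>x. M *v x) ` hyp_plane = hyp_plane}"

definition soliton :: "real set \<Rightarrow> (real \<Rightarrow> real^3) \<Rightarrow> bool" where
  "soliton I X \<longleftrightarrow>
     (\<exists>J Y M. curve_shortening_flow I J X Y \<and>
        smooth_on J M \<and> (\<forall>t\<in>J. M t \<in> hyp_isometries) \<and> M 0 = mat 1 \<and>
        (\<forall>s\<in>I. \<forall>t\<in>J. Y s t = M t *v X s))"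

end

theory Submission
  imports Defs
begin

text \<open>
  The Lie algebra of the isometry group consists of the maps \<open>A x = mcross x v\<close>, and
  \<open>\<langle>A X, N\<rangle> = \<langle>T, v\<rangle>\<close>. Hence differentiating \<open>M t *v X s\<close> at \<open>t = 0\<close> turns the
  flow equation into \<open>\<langle>T, v\<rangle> = k\<close>; if \<open>v = 0\<close>, the curve is a geodesic, and its constant
  normal serves as \<open>v\<close>. Conversely, \<open>M t = exp (t A)\<close> commutes with \<open>A\<close>, so the
  flow equation at time \<open>t\<close> is the image under \<open>M t\<close> of the equation at time \<open>0\<close>.
\<close>

section \<open>Calculus of \<open>Ck_on\<close>\<close>

lemma Ck_on_SucD: "Ck_on (Suc n) S f \<Longrightarrow> Ck_on n S f"
proof (induction n arbitrary: f)
  case 0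
  then show ?case
    by (auto simp: continuous_on_eq_continuous_within dest: has_derivative_continuous)
next
  case (Suc n)
  from Suc.prems obtain f' where "\<forall>x\<in>S. (f has_derivative f' x) (at x within S)"
    and "\<forall>h. Ck_on (Suc n) S (\<lambda>x. f' x h)"
    by (subst (asm) Ck_on.simps) blast
  with Suc.IH show ?case by (auto simp del: Ck_on.simps(1) intro!: exI[of _ f'])
qed

lemma Ck_on_const: "Ck_on n S (\<lambda>x. c)"
  by (induction n arbitrary: c) (auto intro!: exI[of _ "\<lambda>x h. 0"])

text \<open>The derivative of the inner map is \<open>L\<close> at every point, so each directional
  derivative of the composition is again a composition with \<open>L\<close>, namely of
  \<open>\<lambda>x. f' x (L h)\<close>, and the induction closes. The intended \<open>L\<close> are
  the projections of a product of intervals.\<close>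

lemma Ck_on_compose_linear:
  assumes "Ck_on n T f" "bounded_linear L" "L ` S \<subseteq> T"
  shows "Ck_on n S (\<lambda>x. f (L x))"
  using assms(1)
proof (induction n arbitrary: f)
  case 0
  then show ?case
    using assms(2,3) continuous_on_compose2 linear_continuous_on by (fastforce simp: image_subset_iff)
next
  case (Suc n)
  then obtain f' where f': "\<forall>x\<in>T. (f has_derivative f' x) (at x within T)"
    and C: "\<forall>h. Ck_on n T (\<lambda>x. f' x h)" by auto
  have "((\<lambda>x. f (L x)) has_derivative (\<lambda>h. f' (L x) (L h))) (at x within S)" if "x \<in> S" for x
  proof (rule has_derivative_in_compose[where g = f])
    show "(L has_derivative L) (at x within S)"
      by (rule bounded_linear_imp_has_derivative[OF assms(2)])
    show "(f has_derivative f' (L x)) (at (L x) within L ` S)"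
      using f' that assms(3) by (blast intro: has_derivative_subset)
  qed
  with C Suc.IH show ?case by (auto intro!: exI[of _ "\<lambda>x h. f' (L x) (L h)"])
qed

lemma Ck_on_add:
  assumes "Ck_on n S f" "Ck_on n S g"
  shows "Ck_on n S (\<lambda>x. f x + g x)"
  using assms
proof (induction n arbitrary: f g)
  case 0
  then show ?case by (auto intro: continuous_intros)
next
  case (Suc n)
  then obtain f' g' where
    "\<forall>x\<in>S. (f has_derivative f' x) (at x within S)" "\<forall>h. Ck_on n S (\<lambda>x. f' x h)"
    "\<forall>x\<in>S. (g has_derivative g' x) (at x within S)" "\<forall>h. Ck_on n S (\<lambda>x. g' x h)"
    by auto
  with Suc.IH show ?case
    by (auto intro!: exI[of _ "\<lambda>x h. f' x h + g' x h"] has_derivative_add)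
qed

lemma (in bounded_bilinear) Ck_on:
  assumes "Ck_on n S f" "Ck_on n S g"
  shows "Ck_on n S (\<lambda>x. prod (f x) (g x))"
  using assms
proof (induction n arbitrary: f g)
  case 0
  then show ?case by (auto intro: continuous_on)
next
  case (Suc n)
  then obtain f' g' where *:
    "\<forall>x\<in>S. (f has_derivative f' x) (at x within S)" "\<forall>h. Ck_on n S (\<lambda>x. f' x h)"
    "\<forall>x\<in>S. (g has_derivative g' x) (at x within S)" "\<forall>h. Ck_on n S (\<lambda>x. g' x h)"
    by auto
  \<comment> \<open>The product rule keeps \<open>f\<close> and \<open>g\<close> undifferentiated as
    factors; \<open>Ck_on_SucD\<close> supplies them at order \<open>n\<close>.\<close>
  with Suc.IH Ck_on_SucD[OF Suc.prems(1)] Ck_on_SucD[OF Suc.prems(2)] show ?case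
    by (auto intro!: exI[of _ "\<lambda>x h. prod (f x) (g' x h) + prod (f' x h) (g x)"] Ck_on_add FDERIV)
qed

lemma Ck_on_SucI_vector:
  fixes f :: "real \<Rightarrow> 'b::real_normed_vector"
  assumes "\<And>x. x \<in> S \<Longrightarrow> (f has_vector_derivative f' x) (at x within S)" "Ck_on n S f'"
  shows "Ck_on (Suc n) S f"
  using assms unfolding has_vector_derivative_def
  by (auto intro!: exI[of _ "\<lambda>x h. h *\<^sub>R f' x"]
      bounded_bilinear.Ck_on[OF bounded_bilinear_scaleR] Ck_on_const)

lemma Ck_on_SucE_vector:
  fixes f :: "real \<Rightarrow> 'b::real_normed_vector"
  assumes "Ck_on (Suc n) S f"
  obtains f' where "\<And>x. x \<in> S \<Longrightarrow> (f has_vector_derivative f' x) (at x within S)" "Ck_on n S f'"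
proof -
  from assms obtain D where D: "\<forall>x\<in>S. (f has_derivative D x) (at x within S)"
    and C: "\<forall>h. Ck_on n S (\<lambda>x. D x h)" by auto
  have "(f has_vector_derivative D x 1) (at x within S)" if "x \<in> S" for x
  proof -
    have "(f has_derivative D x) (at x within S)" using D that by blast
    \<comment> \<open>A linear map on the reals is multiplication by its value at
      \<open>1\<close>.\<close>
    moreover from has_derivative_linear[OF this] have "D x = (\<lambda>h. h *\<^sub>R D x 1)"
      by (metis linear_cmul mult.right_neutral real_scaleR_def)
    ultimately show ?thesis unfolding has_vector_derivative_def by metis
  qed
  then show thesis using C by (intro that[of "\<lambda>x. D x 1"]) auto
qed

text \<open>A convex set with nonempty interior lies in the closure of that interior, so even the
  endpoints are limit points. This makes one-sided derivatives unique.\<close>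

lemma nondegenerate_interval_at_neq_bot:
  assumes "nondegenerate_interval I" "s \<in> I"
  shows "at s within I \<noteq> bot"
proof -
  have "convex I" "interior I \<noteq> {}" using assms(1)
    by (auto simp: nondegenerate_interval_def is_interval_convex)
  then have "closure (interior I) = closure I" by (rule convex_closure_interior)
  moreover have "closure (interior I) \<subseteq> {x. x islimpt I}"
    by (rule closure_minimal) (auto intro: interior_limit_point closed_limpts)
  ultimately have "s islimpt I"
    using assms(2) closure_subset by blast
  then show ?thesis by (simp add: trivial_limit_within)
qed

section \<open>Minkowski space\<close>

lemma mcross_eq:
  "mcross u v = vector [- (u$2 * v$3 - u$3 * v$2), u$3 * v$1 - u$1 * v$3, u$1 * v$2 - u$2 * v$1]"
proof -
  have "\<forall>w. mink (vector [- (u$2 * v$3 - u$3 * v$2),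
                    u$3 * v$1 - u$1 * v$3, u$1 * v$2 - u$2 * v$1]) w = det (vector [u, v, w] :: real^3^3)"
    by (simp add: mink_def det_3 algebra_simps)
  with mcross_unique mink_mcross show ?thesis by metis
qed

lemma mcross_nth [simp]:
  "mcross u v $ 1 = u$3 * v$2 - u$2 * v$3"
  "mcross u v $ 2 = u$3 * v$1 - u$1 * v$3"
  "mcross u v $ 3 = u$1 * v$2 - u$2 * v$1"
  by (simp_all add: mcross_eq)

lemma bounded_bilinear_mink: "bounded_bilinear mink"
  unfolding bilinear_conv_bounded_bilinear[symmetric] bilinear_def
  by (auto intro!: linearI simp: mink_def algebra_simps)

lemma bounded_bilinear_mcross: "bounded_bilinear mcross"
  unfolding bilinear_conv_bounded_bilinear[symmetric] bilinear_def
  by (auto intro!: linearI simp: vec_eq_iff forall_3 algebra_simps)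

lemma bounded_bilinear_matrix_vector_mult:
  "bounded_bilinear ((*v) :: real^'n^'m \<Rightarrow> real^'n \<Rightarrow> real^'m)"
  unfolding bilinear_conv_bounded_bilinear[symmetric] bilinear_def
  by (auto intro!: linearI simp: matrix_vector_mult_add_rdistrib algebra_simps scaleR_matrix_vector_assoc
      matrix_vector_mult_scaleR)

lemmas mink_linear = bounded_bilinear.add_left[OF bounded_bilinear_mink]
  bounded_bilinear.add_right[OF bounded_bilinear_mink]
  bounded_bilinear.diff_left[OF bounded_bilinear_mink]
  bounded_bilinear.diff_right[OF bounded_bilinear_mink]
  bounded_bilinear.scaleR_left[OF bounded_bilinear_mink]
  bounded_bilinear.scaleR_right[OF bounded_bilinear_mink]

lemma mink_commute: "mink u v = mink v u"
  by (simp add: mink_def)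

lemma mink_nondegenerate:
  assumes "\<And>w. mink z w = 0"
  shows "z = 0"
  using assms[of "axis 1 1"] assms[of "axis 2 1"] assms[of "axis 3 1"]
  by (simp add: mink_def vec_eq_iff forall_3 axis_def)

text \<open>Lagrange's identity; the signature reverses its sign compared with the Euclidean
  one.\<close>

lemma mink_mcross_mcross:
  "mink (mcross a b) (mcross c d) = mink a d * mink b c - mink a c * mink b d"
  by (simp add: mink_def algebra_simps)

lemma mcross_mcross: "mcross (mcross a b) c = mink b c *\<^sub>R a - mink a c *\<^sub>R b"
  by (simp add: vec_eq_iff forall_3 mink_def algebra_simps)

lemma mink_mcross_left [simp]: "mink (mcross a b) a = 0"
  and mink_mcross_right [simp]: "mink (mcross a b) b = 0"
  by (simp_all add: mink_def algebra_simps)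

section \<open>The Lorentz group and the isometries of the hyperbolic plane\<close>

lemma lorentz_iff: "M \<in> lorentz_group \<longleftrightarrow> (\<forall>x y. mink (M *v x) (M *v y) = mink x y)"
proof -
  have form: "mink x y = x \<bullet> (mink_form *v y)" for x y
    by (simp add: mink_def mink_form_def inner_vec_def sum_3 matrix_vector_mult_def)
  have form': "mink (M *v x) (M *v y) = x \<bullet> ((transpose M ** mink_form ** M) *v y)" for x y
    by (simp only: form matrix_vector_mul_assoc[symmetric]) (metis dot_lmul_matrix vector_transpose_matrix)
  \<comment> \<open>Invariance makes a kernel vector orthogonal to everything, hence zero by
    nondegeneracy.\<close>
  have "invertible M" if "\<forall>x y. mink (M *v x) (M *v y) = mink x y"
  proof -
    have "x = 0" if "M *v x = 0" for x
      using \<open>\<forall>x y. _\<close> that by (metis mink_nondegenerate bounded_bilinear.zero_left[OF bounded_bilinear_mink])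
    then show ?thesis
      by (auto simp: invertible_left_inverse matrix_left_invertible_ker)
  qed
  moreover have "P = Q \<longleftrightarrow> (\<forall>x y. x \<bullet> (P *v y) = x \<bullet> (Q *v y))" for P Q :: "real^3^3"
    unfolding matrix_eq using vector_eq_ldot[of "P *v y" "Q *v y" for y] by blast
  then have "transpose M ** mink_form ** M = mink_form \<longleftrightarrow> (\<forall>x y. mink (M *v x) (M *v y) = mink x y)"
    unfolding form' unfolding form .
  ultimately show ?thesis by (auto simp: lorentz_group_def)
qed

lemma mink_lorentz: "M \<in> lorentz_group \<Longrightarrow> mink (M *v x) (M *v y) = mink x y"
  by (simp add: lorentz_iff)

lemma surj_lorentz:
  assumes "M \<in> lorentz_group"
  shows "surj ((*v) M)"
proof -
  have "\<exists>B. M ** B = mat 1"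
    using assms by (simp add: lorentz_group_def invertible_right_inverse)
  then show ?thesis by (simp add: matrix_right_invertible_surjective)
qed

text \<open>Paired with \<open>M *v w'\<close>, both sides become determinants, and applying
  \<open>M\<close> to all three rows multiplies a determinant by \<open>det M\<close>. As
  \<open>M\<close> is onto, nondegeneracy finishes.\<close>

lemma mcross_lorentz:
  assumes "M \<in> lorentz_group"
  shows "mcross (M *v u) (M *v v) = det M *\<^sub>R (M *v mcross u v)"
proof -
  have "mink (mcross (M *v u) (M *v v) - det M *\<^sub>R (M *v mcross u v)) w = 0" for w
  proof -
    obtain w' where w: "w = M *v w'"
      using surj_lorentz[OF assms] by (rule surjE)
    have "(vector [M *v u, M *v v, M *v w'] :: real^3^3) = vector [u, v, w'] ** transpose M"
      by (simp add: vec_eq_iff forall_3 matrix_matrix_mult_def matrix_vector_mult_def transpose_def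
          sum_3 mult.commute)
    then have "det (vector [M *v u, M *v v, M *v w'] :: real^3^3) = det M * det (vector [u, v, w'] :: real^3^3)"
      by (simp add: det_mul det_transpose)
    then show ?thesis using assms by (simp add: w mink_linear mink_lorentz mink_mcross)
  qed
  from mink_nondegenerate[OF this] show ?thesis by simp
qed

lemma hyp_isometriesI:
  assumes "M \<in> lorentz_group" "\<And>x. x \<in> hyp_plane \<Longrightarrow> (M *v x) $ 1 > 0"
  shows "M \<in> hyp_isometries"
proof -
  have into: "M *v x \<in> hyp_plane" if "x \<in> hyp_plane" for x
    using that assms by (simp add: hyp_plane_def mink_lorentz)
  have "y \<in> (*v) M ` hyp_plane" if y: "y \<in> hyp_plane" for y
  proof -
    obtain x where x: "y = M *v x"
      using surj_lorentz[OF assms(1)] by (rule surjE)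
    have q: "mink x x = -1" using y assms(1) by (simp add: x hyp_plane_def mink_lorentz)
    then have "x $ 1 \<noteq> 0" by (auto simp: mink_def) (smt (verit) zero_le_square)
    \<comment> \<open>Otherwise \<open>- x\<close> lies on the upper sheet, while its image
      \<open>- y\<close> has negative first coordinate.\<close>
    moreover have "\<not> x $ 1 < 0"
    proof
      assume "x $ 1 < 0"
      then have "- x \<in> hyp_plane" using q by (simp add: hyp_plane_def mink_def)
      from assms(2)[OF this] y show False
        by (simp add: x hyp_plane_def matrix_vector_mult_def sum_negf)
    qed
    ultimately have "x \<in> hyp_plane" using q by (simp add: hyp_plane_def)
    with x show ?thesis by blast
  qed
  with into assms(1) show ?thesis by (auto simp: hyp_isometries_def)
qed

section \<open>One-parameter groups of isometries\<close>

text \<open>The general element of the Lie algebra so(1,2), written out as a matrix.\<close>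

definition generator :: "real^3 \<Rightarrow> real^3^3" where
  "generator v = vector [vector [0, - v$3, v$2], vector [- v$3, 0, v$1], vector [v$2, - v$1, 0]]"

lemma generator_mult: "generator v *v x = mcross x v"
  by (simp add: generator_def vec_eq_iff forall_3 matrix_vector_mult_def sum_3)

text \<open>Tested on basis vectors, skewness kills the diagonal and ties the other six entries
  together in pairs; the three free values are, up to sign, the coordinates of
  \<open>v\<close>.\<close>

lemma skew_imp_generator:
  assumes "\<And>x y. mink (A *v x) y + mink x (A *v y) = 0"
  shows "\<exists>v. A = generator v"
proof
  show "A = generator (vector [A$2$3, A$1$3, - A$1$2])"
    using assms[of "axis 1 1" "axis 1 1"] assms[of "axis 1 1" "axis 2 1"] assms[of "axis 1 1" "axis 3 1"]
      assms[of "axis 2 1" "axis 2 1"] assms[of "axis 2 1" "axis 3 1"] assms[of "axis 3 1" "axis 3 1"]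
    by (simp add: generator_def vec_eq_iff forall_3 mink_def axis_def matrix_vector_mult_def sum_3)
qed

text \<open>If the cube of \<open>A\<close> is \<open>c *\<^sub>R A\<close>, then comparing
  coefficients in the derivative of \<open>mat 1 + f t *\<^sub>R A + g t *\<^sub>R (A ** A)\<close>
  gives exactly this system. The sign of \<open>c\<close> decides between polynomial, trigonometric
  and hyperbolic solutions.\<close>

lemma generalized_sinh_exists:
  fixes c :: real
  obtains f g :: "real \<Rightarrow> real" where "f 0 = 0" "g 0 = 0"
    "\<And>t. (f has_real_derivative 1 + c * g t) (at t)" "\<And>t. (g has_real_derivative f t) (at t)"
proof (cases c "0::real" rule: linorder_cases)
  case equal
  then show ?thesis
    by (intro that[of "\<lambda>t. t" "\<lambda>t. t\<^sup>2 / 2"]) (auto intro!: derivative_eq_intros)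
next
  case less
  define r where "r = sqrt (- c)"
  have r: "c = - r\<^sup>2" "r \<noteq> 0" using less by (auto simp: r_def)
  show ?thesis
    by (intro that[of "\<lambda>t. sin (r * t) / r" "\<lambda>t. (1 - cos (r * t)) / r\<^sup>2"])
      (auto intro!: derivative_eq_intros simp: r field_simps power2_eq_square)
next
  case greater
  define r where "r = sqrt c"
  have r: "c = r\<^sup>2" "r \<noteq> 0" using greater by (auto simp: r_def)
  show ?thesis
    by (intro that[of "\<lambda>t. sinh (r * t) / r" "\<lambda>t. (cosh (r * t) - 1) / r\<^sup>2"])
      (auto intro!: derivative_eq_intros simp: r field_simps power2_eq_square)
qed

text \<open>
  Since the cube of \<open>A = generator v\<close> is \<open>mink v v *\<^sub>R A\<close>, the exponential of \<open>t *\<^sub>R A\<close>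
  is \<open>mat 1 + f t *\<^sub>R A + g t *\<^sub>R A\<^sup>2\<close> with scalar \<open>f\<close> and \<open>g\<close>.
\<close>

lemma one_parameter_group_exists:
  obtains M :: "real \<Rightarrow> real^3^3" where "smooth_on UNIV M" "M 0 = mat 1" "\<And>t. M t \<in> hyp_isometries"
    "\<And>t x. ((\<lambda>t. M t *v x) has_vector_derivative M t *v mcross x v) (at t)"
proof -
  define c where "c = mink v v"
  obtain f g :: "real \<Rightarrow> real" where f0: "f 0 = 0" and g0: "g 0 = 0"
    and f': "\<And>t. (f has_real_derivative 1 + c * g t) (at t)"
    and g': "\<And>t. (g has_real_derivative f t) (at t)"
    using generalized_sinh_exists[of c] by metis
  define A where "A = generator v"
  define M where "M = (\<lambda>t. mat 1 + f t *\<^sub>R A + g t *\<^sub>R (A ** A))"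
  have A3: "mcross (mcross (mcross x v) v) v = c *\<^sub>R mcross x v" for x
    by (simp add: c_def vec_eq_iff forall_3 mink_def algebra_simps)
  have Mx: "M t *v x = x + f t *\<^sub>R mcross x v + g t *\<^sub>R mcross (mcross x v) v" for t x
    by (simp add: M_def A_def matrix_vector_mult_add_rdistrib generator_mult matrix_vector_mul_assoc[symmetric]
        scaleR_matrix_vector_assoc[symmetric])
  have M': "((\<lambda>t. M t *v x) has_vector_derivative M t *v mcross x v) (at t)" for t x
    unfolding Mx A3
    by (rule derivative_eq_intros f' g' refl | simp add: algebra_simps)+
  have comm: "M t *v mcross x v = mcross (M t *v x) v" for t x
    unfolding Mx
    by (simp add: bounded_bilinear.add_left[OF bounded_bilinear_mcross]
        bounded_bilinear.scaleR_left[OF bounded_bilinear_mcross])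
  have M0: "M 0 = mat 1" by (simp add: M_def f0 g0)
  have Lor: "M t \<in> lorentz_group" for t
  proof -
    have "mink (M t *v x) (M t *v y) = mink x y" for x y
    proof -
      \<comment> \<open>Since \<open>M t\<close> commutes with the generator by \<open>comm\<close>,
        this derivative vanishes by skewness of the generator; the constant value is the one at
        \<open>t = 0\<close>.\<close>
      have "((\<lambda>t. mink (M t *v x) (M t *v y)) has_vector_derivative 0) (at t within UNIV)" for t
      proof -
        have "mink (M t *v x) (mcross (M t *v y) v) + mink (mcross (M t *v x) v) (M t *v y) = 0"
          by (simp add: mink_def algebra_simps)
        with bounded_bilinear.has_vector_derivative[OF bounded_bilinear_mink M'[of x t] M'[of y t]]
        show ?thesis by (simp add: comm)
      qed
      then obtain d where "\<And>t. t \<in> UNIV \<Longrightarrow> mink (M t *v x) (M t *v y) = d"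
        by (rule has_vector_derivative_zero_constant[OF convex_UNIV]) blast
      then have "mink (M t *v x) (M t *v y) = mink (M 0 *v x) (M 0 *v y)" by simp
      then show ?thesis by (simp add: M0)
    qed
    then show ?thesis by (simp add: lorentz_iff)
  qed
  have iso: "M t \<in> hyp_isometries" for t
  proof (rule hyp_isometriesI[OF Lor])
    fix x assume x: "x \<in> hyp_plane"
    \<comment> \<open>The orbit cannot jump to the lower sheet: a vector with product
      \<open>-1\<close> has nonzero first coordinate, so by continuity the sign is the one at
      \<open>t = 0\<close>.\<close>
    have nz: "(M t *v x) $ 1 \<noteq> 0" for t
    proof
      assume "(M t *v x) $ 1 = 0"
      then have "mink (M t *v x) (M t *v x) \<ge> 0" by (simp add: mink_def)
      with x show False by (simp add: mink_lorentz[OF Lor] hyp_plane_def)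
    qed
    have "continuous_on UNIV (\<lambda>t. M t *v x)"
      using M' by (meson continuous_at_imp_continuous_on has_vector_derivative_continuous)
    then have "connected (range (\<lambda>t. (M t *v x) $ 1))" (is "connected ?C")
      by (intro connected_continuous_image continuous_on_component connected_UNIV)
    moreover have "(M 0 *v x) $ 1 > 0" using x by (simp add: M0 hyp_plane_def)
    moreover have "0 \<notin> ?C" using nz by force
    ultimately show "(M t *v x) $ 1 > 0"
      using connectedD_interval[of ?C "(M t *v x) $ 1" "(M 0 *v x) $ 1" 0] by force
  qed
  \<comment> \<open>Each derivative is affine in the other function, so both gain regularity
    together.\<close>
  have "Ck_on n UNIV f \<and> Ck_on n UNIV g" for n
  proof (induction n)
    case 0
    then show ?case using f' g'
      by (auto intro!: continuous_at_imp_continuous_on DERIV_isCont)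
  next
    case (Suc n)
    have "Ck_on n UNIV (\<lambda>t. 1 + c * g t)"
      using Suc by (intro Ck_on_add bounded_bilinear.Ck_on[OF bounded_bilinear_mult] Ck_on_const) auto
    with Suc show ?case
      using f' g' by (auto intro!: Ck_on_SucI_vector simp: has_real_derivative_iff_has_vector_derivative
          simp del: Ck_on.simps)
  qed
  then have "smooth_on UNIV M"
    unfolding smooth_on_def M_def
    by (auto intro!: Ck_on_add bounded_bilinear.Ck_on[OF bounded_bilinear_scaleR] Ck_on_const)
  then show thesis using M0 iso M' by (rule that)
qed

section \<open>The Frenet apparatus\<close>

locale arc_length_curve =
  fixes I :: "real set" and X :: "real \<Rightarrow> real^3"
  assumes interval: "nondegenerate_interval I"
    and regular: "regular_curve I X"
    and arc_length: "arc_length_parametrized I X"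
begin

abbreviation "T \<equiv> unit_tangent I X"
abbreviation "N \<equiv> unit_normal I X"
abbreviation "k \<equiv> geodesic_curvature I X"
abbreviation "T' \<equiv> curve_deriv I T"

lemmas at_neq_bot = nondegenerate_interval_at_neq_bot[OF interval]

lemma speed_eq_1: "s \<in> I \<Longrightarrow> speed I X s = 1"
  using arc_length by (simp add: arc_length_parametrized_def)

lemma T_eq: "s \<in> I \<Longrightarrow> T s = curve_deriv I X s"
  by (simp add: unit_tangent_def speed_eq_1)

lemma
  assumes s: "s \<in> I"
  shows X_deriv: "(X has_vector_derivative T s) (at s within I)"
    and T_deriv: "(T has_vector_derivative T' s) (at s within I)"
proof -
  have "Ck_on (Suc (Suc 0)) I X"
    using regular unfolding regular_curve_def smooth_on_def by blast
  then obtain D where D: "\<And>s. s \<in> I \<Longrightarrow> (X has_vector_derivative D s) (at s within I)"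
    and CD: "Ck_on (Suc 0) I D" by (rule Ck_on_SucE_vector) blast
  obtain D' where D': "\<And>s. s \<in> I \<Longrightarrow> (D has_vector_derivative D' s) (at s within I)"
    using CD by (rule Ck_on_SucE_vector) blast
  have T: "T s = D s" if "s \<in> I" for s
    using that by (simp add: T_eq vector_derivative_within[OF at_neq_bot D])
  show "(X has_vector_derivative T s) (at s within I)" using D[OF s] T[OF s] by simp
  have "(T has_vector_derivative D' s) (at s within I)"
    by (rule has_vector_derivative_transform[OF s _ D'[OF s]]) (rule T)
  then show "(T has_vector_derivative T' s) (at s within I)"
    using vector_derivative_within[OF at_neq_bot[OF s]] by metis
qed

lemma mink_TT: "s \<in> I \<Longrightarrow> mink (T s) (T s) = 1"
  using speed_eq_1[of s] by (simp add: speed_def T_eq)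

lemma mink_XX: "s \<in> I \<Longrightarrow> mink (X s) (X s) = -1"
  using regular by (auto simp: regular_curve_def hyp_plane_def)

text \<open>Differentiating the constant products of \<open>X\<close> and \<open>T\<close> yields
  all the relations between \<open>X\<close>, \<open>T\<close> and \<open>T'\<close> below.\<close>

lemma mink_deriv_const:
  assumes "s \<in> I" "(f has_vector_derivative f') (at s within I)" "(g has_vector_derivative g') (at s within I)"
    "\<And>s. s \<in> I \<Longrightarrow> mink (f s) (g s) = c"
  shows "mink (f s) g' + mink f' (g s) = 0"
proof -
  have "((\<lambda>s. mink (f s) (g s)) has_vector_derivative mink (f s) g' + mink f' (g s)) (at s within I)"
    by (rule bounded_bilinear.has_vector_derivative[OF bounded_bilinear_mink assms(2,3)])
  moreover have "((\<lambda>s. mink (f s) (g s)) has_vector_derivative 0) (at s within I)"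
    by (rule has_vector_derivative_transform[OF assms(1) _ has_vector_derivative_const[of c]])
      (simp add: assms(4))
  ultimately show ?thesis by (rule vector_derivative_unique_within[OF at_neq_bot[OF assms(1)]])
qed

lemma mink_XT: "s \<in> I \<Longrightarrow> mink (X s) (T s) = 0"
  using mink_deriv_const[OF _ X_deriv X_deriv mink_XX] by (simp add: mink_commute)

lemma mink_TX: "s \<in> I \<Longrightarrow> mink (T s) (X s) = 0"
  using mink_XT by (simp add: mink_commute)

lemma mink_TT': "s \<in> I \<Longrightarrow> mink (T s) (T' s) = 0"
  using mink_deriv_const[OF _ T_deriv T_deriv mink_TT] by (simp add: mink_commute)

lemma mink_XT': "s \<in> I \<Longrightarrow> mink (X s) (T' s) = -1"
  using mink_deriv_const[OF _ X_deriv T_deriv mink_XT] mink_TT by fastforce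

lemma k_eq: "s \<in> I \<Longrightarrow> k s = mink (T' s) (N s)"
  by (simp add: geodesic_curvature_def speed_eq_1)

text \<open>The normal component of the velocity field \<open>\<lambda>x. mcross x v\<close> along
  the curve. In Lagrange's identity \<open>mink (X s) (T s) = 0\<close> removes one term, and
  \<open>mink (X s) (X s) = -1\<close> fixes the sign of the other.\<close>

lemma mink_mcross_N: "s \<in> I \<Longrightarrow> mink (mcross (X s) v) (N s) = mink (T s) v"
  by (simp add: unit_normal_def mink_mcross_mcross mink_XX mink_XT mink_TX mink_commute[of v])

text \<open>
  The factor \<open>det L\<close> below occurs on both sides of the flow equation, so orientation
  reversing \<open>L\<close> need no separate treatment.
\<close>

lemma
  assumes L: "L \<in> lorentz_group" and Z: "\<And>s. s \<in> I \<Longrightarrow> Z s = L *v X s" and s: "s \<in> I"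
  shows curve_deriv_lorentz: "curve_deriv I Z s = L *v T s"
    and unit_normal_lorentz: "unit_normal I Z s = det L *\<^sub>R (L *v N s)"
    and geodesic_curvature_lorentz: "geodesic_curvature I Z s = det L * k s"
proof -
  \<comment> \<open>Kept general because it is applied both to the curve and to its unit tangent
    field.\<close>
  have D: "curve_deriv I W s = L *v V'"
    if s: "s \<in> I" and W: "\<And>s. s \<in> I \<Longrightarrow> W s = L *v V s"
      and V: "(V has_vector_derivative V') (at s within I)" for W V V' s
  proof -
    have "((\<lambda>s. L *v V s) has_vector_derivative L *v V') (at s within I)"
      by (rule bounded_linear.has_vector_derivative
          [OF bounded_bilinear.bounded_linear_right[OF bounded_bilinear_matrix_vector_mult] V])
    from has_vector_derivative_transform[OF s W this]
    show ?thesis by (rule vector_derivative_within[OF at_neq_bot[OF s]])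
  qed
  have DZ: "curve_deriv I Z s = L *v T s" if "s \<in> I" for s
    by (rule D[OF that Z X_deriv[OF that]])
  then show "curve_deriv I Z s = L *v T s" using s by blast
  have speed: "speed I Z s = 1" if "s \<in> I" for s
    using that by (simp add: speed_def DZ mink_lorentz[OF L] mink_TT)
  have TZ: "unit_tangent I Z s = L *v T s" if "s \<in> I" for s
    using that by (simp add: unit_tangent_def[of I Z] speed DZ)
  show N: "unit_normal I Z s = det L *\<^sub>R (L *v N s)"
    using s by (simp add: unit_normal_def TZ Z mcross_lorentz[OF L])
  show "geodesic_curvature I Z s = det L * k s"
    using s by (simp add: geodesic_curvature_def[of I Z] speed N D[OF s TZ T_deriv] k_eq mink_linear
        mink_lorentz[OF L])
qed

text \<open>Zero curvature leaves the geodesic equation \<open>T' s = X s\<close>, so both terms in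
  the derivative of \<open>mcross (X s) (T s)\<close> vanish. The constant normal is a unit vector
  orthogonal to \<open>T\<close>.\<close>

lemma geodesic_normal_vector:
  assumes zero: "\<And>s. s \<in> I \<Longrightarrow> k s = 0"
  shows "\<exists>v. v \<noteq> 0 \<and> (\<forall>s\<in>I. mink (T s) v = k s)"
proof -
  have NN: "mink (N s) (N s) = 1" if "s \<in> I" for s
    using that by (simp add: unit_normal_def mink_mcross_mcross mink_XX mink_TT mink_XT mink_TX)
  have T'X: "T' s = X s" if s: "s \<in> I" for s
  proof -
    define u where "u = T' s - X s"
    have u: "mink (T s) u = 0" "mink (X s) u = 0"
      using s by (simp_all add: u_def mink_linear mink_TT' mink_XT' mink_TX mink_XX)
    have uN: "mink u (N s) = 0"
      using zero[OF s] k_eq[OF s] mink_mcross_left[of "X s" "T s"]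
      by (simp add: u_def mink_linear unit_normal_def mink_commute[of "X s"])
    \<comment> \<open>Being orthogonal to \<open>X s\<close> and \<open>T s\<close>, the vector
      \<open>u\<close> has zero cross product with their cross product \<open>N s\<close>. Crossing
      with \<open>N s\<close> once more gives \<open>- u\<close>, because \<open>u\<close> is also
      orthogonal to the unit vector \<open>N s\<close>.\<close>
    have "mcross (N s) u = 0" by (simp add: unit_normal_def mcross_mcross u)
    then have "mcross (mcross (N s) u) (N s) = 0"
      by (simp add: bounded_bilinear.zero_left[OF bounded_bilinear_mcross])
    then have "u = 0" by (simp add: mcross_mcross uN NN[OF s])
    then show ?thesis by (simp add: u_def)
  qed
  have "(N has_vector_derivative 0) (at s within I)" if s: "s \<in> I" for s
  proof -
    have self: "mcross a a = 0" for a by (simp add: vec_eq_iff forall_3)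
    have "((\<lambda>s. mcross (X s) (T s)) has_vector_derivative mcross (X s) (T' s) + mcross (T s) (T s))
        (at s within I)"
      by (rule bounded_bilinear.has_vector_derivative[OF bounded_bilinear_mcross X_deriv[OF s] T_deriv[OF s]])
    then show ?thesis by (simp add: T'X[OF s] self unit_normal_def[abs_def])
  qed
  moreover have "convex I" using interval by (simp add: nondegenerate_interval_def is_interval_convex)
  ultimately obtain v where v: "\<And>s. s \<in> I \<Longrightarrow> N s = v"
    using has_vector_derivative_zero_constant[of I N] by blast
  from interval obtain s where "s \<in> I"
    using interior_subset by (fastforce simp: nondegenerate_interval_def)
  from NN[OF this] v[OF this] have "v \<noteq> 0" by (auto simp: mink_def)
  moreover have "mink (T s) v = k s" if s: "s \<in> I" for s
    using mink_mcross_right[of "X s" "T s"] v[OF s] zero[OF s] by (simp add: unit_normal_def mink_commute)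
  ultimately show ?thesis by blast
qed

section \<open>The two directions of the equivalence\<close>

lemma soliton_imp_tangent_equation:
  assumes "soliton I X"
  obtains v where "\<And>s. s \<in> I \<Longrightarrow> mink (T s) v = k s"
proof -
  from assms obtain J Y M where F: "curve_shortening_flow I J X Y" and "smooth_on J M"
    and iso: "\<forall>t\<in>J. M t \<in> hyp_isometries" and M0: "M 0 = mat 1"
    and Y: "\<forall>s\<in>I. \<forall>t\<in>J. Y s t = M t *v X s" unfolding soliton_def by blast
  have J: "nondegenerate_interval J" "0 \<in> J" using F by (auto simp: curve_shortening_flow_def)
  note nb = nondegenerate_interval_at_neq_bot[OF J]
  have "Ck_on (Suc 0) J M" using \<open>smooth_on J M\<close> by (auto simp: smooth_on_def simp del: Ck_on.simps)
  then obtain M' where "\<And>t. t \<in> J \<Longrightarrow> (M has_vector_derivative M' t) (at t within J)"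
    by (rule Ck_on_SucE_vector) blast
  from this[OF J(2)] have M': "((\<lambda>t. M t *v x) has_vector_derivative M' 0 *v x) (at 0 within J)" for x
    by (rule bounded_linear.has_vector_derivative
        [OF bounded_bilinear.bounded_linear_left[OF bounded_bilinear_matrix_vector_mult]])
  \<comment> \<open>The velocity of the isometries at the identity is skew, since
    \<open>mink (M t *v x) (M t *v y)\<close> is constant in \<open>t\<close>.\<close>
  have "mink (M' 0 *v x) y + mink x (M' 0 *v y) = 0" for x y
  proof -
    have "((\<lambda>t. mink (M t *v x) (M t *v y)) has_vector_derivative
        mink (M 0 *v x) (M' 0 *v y) + mink (M' 0 *v x) (M 0 *v y)) (at 0 within J)"
      by (rule bounded_bilinear.has_vector_derivative[OF bounded_bilinear_mink M' M'])
    moreover have "((\<lambda>t. mink (M t *v x) (M t *v y)) has_vector_derivative 0) (at 0 within J)"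
      by (rule has_vector_derivative_transform[OF J(2) _ has_vector_derivative_const[of "mink x y"]])
        (use iso in \<open>simp add: hyp_isometries_def mink_lorentz\<close>)
    ultimately have "mink (M 0 *v x) (M' 0 *v y) + mink (M' 0 *v x) (M 0 *v y) = 0"
      by (rule vector_derivative_unique_within[OF nb])
    then show ?thesis by (simp add: M0)
  qed
  then obtain v where v: "M' 0 = generator v" using skew_imp_generator by blast
  have "mink (T s) v = k s" if s: "s \<in> I" for s
  proof -
    have L: "(mat 1 :: real^3^3) \<in> lorentz_group" by (simp add: lorentz_iff)
    \<comment> \<open>\<open>Y \<sigma> 0\<close> agrees with \<open>X \<sigma>\<close> only on
      \<open>I\<close>; viewing it as the image under \<open>mat 1\<close> lets the Lorentz lemmas
      transfer normal and curvature.\<close>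
    have Y0: "Y \<sigma> 0 = mat 1 *v X \<sigma>" if "\<sigma> \<in> I" for \<sigma> using Y that J M0 by simp
    have "((\<lambda>t. Y s t) has_vector_derivative mcross (X s) v) (at 0 within J)"
      by (rule has_vector_derivative_transform[OF J(2) _ M'[of "X s", unfolded v generator_mult]])
        (use Y s in auto)
    note Y' = vector_derivative_within[OF nb this]
    have "mink (mcross (X s) v) (unit_normal I (\<lambda>\<sigma>. Y \<sigma> 0) s) = geodesic_curvature I (\<lambda>\<sigma>. Y \<sigma> 0) s"
      using F s J unfolding curve_shortening_flow_def Y'[symmetric] by blast
    then show ?thesis
      using mink_mcross_N[OF s, of v]
      by (simp add: unit_normal_lorentz[OF L Y0 s] geodesic_curvature_lorentz[OF L Y0 s])
  qed
  then show thesis by (rule that)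
qed

lemma tangent_equation_imp_soliton:
  assumes v: "\<And>s. s \<in> I \<Longrightarrow> mink (T s) v = k s"
  shows "soliton I X"
proof -
  obtain M where M: "smooth_on UNIV M" "M 0 = mat 1" "\<And>t. M t \<in> hyp_isometries"
    and M': "\<And>t x. ((\<lambda>t. M t *v x) has_vector_derivative M t *v mcross x v) (at t)"
    using one_parameter_group_exists[of v] by metis
  have L: "M t \<in> lorentz_group" for t using M(3)[of t] by (simp add: hyp_isometries_def)
  have smX: "smooth_on I X" and XH: "X ` I \<subseteq> hyp_plane" using regular by (auto simp: regular_curve_def)
  have "curve_shortening_flow I UNIV X (\<lambda>s t. M t *v X s)"
    unfolding curve_shortening_flow_def
  proof (intro conjI ballI)
    show "nondegenerate_interval UNIV" by (simp add: nondegenerate_interval_def is_interval_univ)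
    \<comment> \<open>Jointly in both variables, the flow is the bilinear product of
      \<open>M\<close> after \<open>snd\<close> and \<open>X\<close> after
      \<open>fst\<close>.\<close>
    show "smooth_on (I \<times> UNIV) (\<lambda>(s, t). M t *v X s)"
      using M(1) smX unfolding smooth_on_def case_prod_unfold
      by (auto intro!: bounded_bilinear.Ck_on[OF bounded_bilinear_matrix_vector_mult]
          Ck_on_compose_linear[where T = UNIV and L = snd and f = M]
          Ck_on_compose_linear[where T = I and L = fst and f = X] bounded_linear_fst bounded_linear_snd)
    show "regular_curve I (\<lambda>s. M t *v X s)" for t
      unfolding regular_curve_def
    proof (intro conjI ballI)
      show "smooth_on I (\<lambda>s. M t *v X s)"
        using smX unfolding smooth_on_def
        by (auto intro!: bounded_bilinear.Ck_on[OF bounded_bilinear_matrix_vector_mult] Ck_on_const)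
      show "(\<lambda>s. M t *v X s) ` I \<subseteq> hyp_plane"
        using XH M(3)[of t] by (auto simp: hyp_isometries_def)
      fix s assume s: "s \<in> I"
      have "mink (curve_deriv I (\<lambda>s. M t *v X s) s) (curve_deriv I (\<lambda>s. M t *v X s) s) = 1"
        by (simp add: curve_deriv_lorentz[OF L refl s] mink_lorentz[OF L] mink_TT[OF s])
      then show "curve_deriv I (\<lambda>s. M t *v X s) s \<noteq> 0" by (auto simp: mink_def)
    qed
    fix s t assume s: "s \<in> I"
    \<comment> \<open>The velocity is \<open>M t *v mcross (X s) v\<close>, so its normal component
      is \<open>det (M t) * mink (T s) v\<close>, and the curvature is
      \<open>det (M t) * k s\<close>.\<close>
    show "mink (vector_derivative (\<lambda>\<tau>. M \<tau> *v X s) (at t)) (unit_normal I (\<lambda>\<sigma>. M t *v X \<sigma>) s) =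
        geodesic_curvature I (\<lambda>\<sigma>. M t *v X \<sigma>) s"
      by (simp add: vector_derivative_at[OF M'] unit_normal_lorentz[OF L refl s]
          geodesic_curvature_lorentz[OF L refl s] mink_linear mink_lorentz[OF L] mink_mcross_N[OF s] v[OF s])
  qed (simp_all add: M(2))
  with M(1,2,3) show ?thesis
    unfolding soliton_def
    by (intro exI[of _ UNIV] exI[of _ "\<lambda>s t. M t *v X s"] exI[of _ M]) simp
qed

end

theorem theorem2p2:
  fixes I :: "real set" and X :: "real \<Rightarrow> real^3"
  assumes "nondegenerate_interval I"
    and "regular_curve I X"
    and "arc_length_parametrized I X"
  shows "soliton I X \<longleftrightarrow>
    (\<exists>v::real^3. v \<noteq> 0 \<and> (\<forall>s\<in>I. mink (unit_tangent I X s) v = geodesic_curvature I X s))"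
proof -
  interpret arc_length_curve I X using assms by unfold_locales
  show ?thesis
  proof
    assume "soliton I X"
    then obtain v where v: "\<And>s. s \<in> I \<Longrightarrow> mink (T s) v = k s"
      by (rule soliton_imp_tangent_equation) blast
    show "\<exists>v. v \<noteq> 0 \<and> (\<forall>s\<in>I. mink (unit_tangent I X s) v = geodesic_curvature I X s)"
    \<comment> \<open>The zero vector does occur, for instance for a geodesic with
      \<open>M t = mat 1\<close> throughout.\<close>
    proof (cases "v = 0")
      case True
      then have "k s = 0" if "s \<in> I" for s
        using v[OF that] by (simp add: mink_def)
      then show ?thesis by (rule geodesic_normal_vector)
    next
      case False
      with v show ?thesis by blast
    qed
  next
    assume "\<exists>v. v \<noteq> 0 \<and> (\<forall>s\<in>I. mink (unit_tangent I X s) v = geodesic_curvature I X s)"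
    then show "soliton I X" using tangent_equation_imp_soliton by blast
  qed
qed

end
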